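(* Let $\Omega$ be a bounded domain of $\mathbb{R}^N$, $g\in \mathrm{C}(\partial\Omega)$ a non-constant function, and $\mathcal{H}:=\{u\in \mathrm{C}^2(\Omega)\cap \mathrm{C}^1(\overline\Omega):\ u|_{\partial\Omega}=g\}$. Let $L=L(x,u,z)\in \mathrm{C}^1(\overline\Omega\times\mathbb{R}\times\mathbb{R}^N)$ be a real-valued Lagrangian satisfying, for all $x\in\Omega$ and $u\in\mathbb{R}$, $$\sum_{i=1}^N L_{x_iz_i}(x,u,0)=0\qquad\text{and}\qquad L_{x_iu}(x,u,0)=0\ \text{ for all } i=1,\dots,N.$$ Then the Euler-Lagrange and Noether equations for $L$ are equivalent in $\mathcal{H}$; that is, for every $u\in\mathcal{H}$, $u$ satisfies the Euler-Lagrange equation $$\sum_{j=1}^N\frac{\partial}{\partial x_j}\big[L_{z_j}(x,u(x),Du(x))\big]-L_u(x,u(x),Du(x))=0\quad\text{for all }x\in\Omega$$ if and only if $u$ satisfies Noether's equations $$\sum_{j=1}^N\frac{\partial}{\partial x_j}\big[T_{ij}(x,u(x),Du(x))\big]+L_{x_i}(x,u(x),Du(x))=0\quad\text{for all }x\in\Omega,\ i=1,\dots,N.$$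
   Context: A domain is an open connected subset of $\mathbb{R}^N$. Functions are real-valued. $\mathrm{C}^1(\overline\Omega)$ denotes the set of restrictions to $\Omega$ of continuously differentiable functions on $\mathbb{R}^N$, and similarly for $\mathrm{C}^1(\overline\Omega\times\mathbb{R}\times\mathbb{R}^N)$; the boundary values $u|_{\partial\Omega}$ are those of the continuous extension of $u$ to $\overline\Omega$. Subscripts on $L$ denote partial derivatives with respect to the independent variables $x\in\Omega$, $u\in\mathbb{R}$, $z\in\mathbb{R}^N$ ($z$ is the slot for $Du$); the second-order derivatives of $L$ appearing in the hypothesis are understood to exist where they are written. $\frac{\partial}{\partial x_j}[\cdots]$ denotes the derivative of the composed function of $x$. The energy-momentum tensor is $T_{ij}(x,u,z)=z_iL_{z_j}(x,u,z)-\delta_{ij}L(x,u,z)$.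
   Formalization: Noether ⇒ Euler-Lagrange is stated only for u whose derivatives ∂/∂x_j[L_{z_j}(x,u,Du)] exist and are continuous in Ω (automatic if the L_{z_j} are C¹); it fails for L merely C¹, e.g. L=2|z|^{3/2}+u. Euler-Lagrange ⇒ Noether holds for every u in H. *)

theory Defs
  imports "HOL-Analysis.Analysis"
begin

definition C1_on :: "'a::real_normed_vector set \<Rightarrow> ('a \<Rightarrow> 'b::real_normed_vector) \<Rightarrow> bool" where
  "C1_on S f \<longleftrightarrow>
     (\<exists>f' :: 'a \<Rightarrow> 'a \<Rightarrow>\<^sub>L 'b.
        (\<forall>x\<in>S. (f has_derivative blinfun_apply (f' x)) (at x)) \<and> continuous_on S f')"

definition C2_on :: "'a::real_normed_vector set \<Rightarrow> ('a \<Rightarrow> 'b::real_normed_vector) \<Rightarrow> bool" where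
  "C2_on S f \<longleftrightarrow>
     (\<exists>f' :: 'a \<Rightarrow> 'a \<Rightarrow>\<^sub>L 'b.
        (\<forall>x\<in>S. (f has_derivative blinfun_apply (f' x)) (at x)) \<and> C1_on S f')"

definition C1_closure :: "'a::real_normed_vector set \<Rightarrow> ('a \<Rightarrow> 'b::real_normed_vector) \<Rightarrow> bool" where
  "C1_closure S f \<longleftrightarrow> (\<exists>F. C1_on UNIV F \<and> (\<forall>x\<in>S. f x = F x))"

text \<open>A function \<open>u\<close> on \<open>\<Omega>\<close> is represented by a total function whose values outside \<open>\<Omega>\<close> are
  irrelevant; boundary values are therefore limits from inside \<open>\<Omega>\<close>.\<close>

definition admissible :: "(real^'n) set \<Rightarrow> (real^'n \<Rightarrow> real) \<Rightarrow> (real^'n \<Rightarrow> real) set" where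
  "admissible \<Omega> g =
     {u. C2_on \<Omega> u \<and> C1_closure \<Omega> u \<and> (\<forall>x\<in>frontier \<Omega>. (u \<longlongrightarrow> g x) (at x within \<Omega>))}"

text \<open>\<open>pd i f x\<close> is meaningful only where \<open>has_pd i f x\<close> holds.\<close>

definition has_pd :: "'n::finite \<Rightarrow> (real^'n \<Rightarrow> real) \<Rightarrow> real^'n \<Rightarrow> bool" where
  "has_pd i f x \<longleftrightarrow> (\<lambda>t. f (x + t *\<^sub>R axis i 1)) field_differentiable (at 0)"

definition pd :: "'n::finite \<Rightarrow> (real^'n \<Rightarrow> real) \<Rightarrow> real^'n \<Rightarrow> real" where
  "pd i f x = deriv (\<lambda>t. f (x + t *\<^sub>R axis i 1)) 0"

definition grad :: "(real^'n \<Rightarrow> real) \<Rightarrow> real^'n \<Rightarrow> real^'n" where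
  "grad u x = (\<chi> i. pd i u x)"

type_synonym 'n lagrangian = "real^'n \<Rightarrow> real \<Rightarrow> real^'n \<Rightarrow> real"

definition Lx :: "'n::finite \<Rightarrow> 'n lagrangian \<Rightarrow> 'n lagrangian" where
  "Lx i L x u z = pd i (\<lambda>y. L y u z) x"

definition Lu :: "('n::finite) lagrangian \<Rightarrow> 'n lagrangian" where
  "Lu L x u z = deriv (\<lambda>s. L x s z) u"

definition Lz :: "'n::finite \<Rightarrow> 'n lagrangian \<Rightarrow> 'n lagrangian" where
  "Lz i L x u z = pd i (\<lambda>w. L x u w) z"

definition energy_momentum :: "('n::finite) lagrangian \<Rightarrow> 'n \<Rightarrow> 'n \<Rightarrow> 'n lagrangian" where
  "energy_momentum L i j x u z = z $ i * Lz j L x u z - (if i = j then L x u z else 0)"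

definition along :: "('n::finite) lagrangian \<Rightarrow> (real^'n \<Rightarrow> real) \<Rightarrow> real^'n \<Rightarrow> real" where
  "along F u x = F x (u x) (grad u x)"

definition euler_lagrange :: "(real^'n) set \<Rightarrow> 'n lagrangian \<Rightarrow> (real^'n \<Rightarrow> real) \<Rightarrow> bool" where
  "euler_lagrange \<Omega> L u \<longleftrightarrow>
     (\<forall>x\<in>\<Omega>. (\<forall>j. has_pd j (along (Lz j L) u) x) \<and>
        (\<Sum>j\<in>UNIV. pd j (along (Lz j L) u) x) - along (Lu L) u x = 0)"

definition noether :: "(real^'n) set \<Rightarrow> 'n lagrangian \<Rightarrow> (real^'n \<Rightarrow> real) \<Rightarrow> bool" where
  "noether \<Omega> L u \<longleftrightarrow>
     (\<forall>x\<in>\<Omega>. \<forall>i. (\<forall>j. has_pd j (along (energy_momentum L i j) u) x) \<and>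
        (\<Sum>j\<in>UNIV. pd j (along (energy_momentum L i j) u) x) + along (Lx i L) u x = 0)"

text \<open>The derivatives in the Euler-Lagrange equation exist classically and continuously along \<open>u\<close>;
  this holds for every \<open>u\<close> of class \<open>C\<^sup>2\<close> as soon as the \<open>Lz j L\<close> are of class \<open>C\<^sup>1\<close> in \<open>(x,u,z)\<close>.
  Without it Noether's equations do not imply the Euler-Lagrange equation: for \<open>N = 1\<close>,
  \<open>\<Omega> = (-1,1)\<close>, \<open>L(x,u,z) = 2 \<bar>z\<bar>\<^bsup>3/2\<^esup> + u\<close>, the function \<open>u(x) = (max x 0 / 3)\<^sup>3\<close> has \<open>T = 0\<close>
  along \<open>u\<close> and \<open>L\<^sub>x = 0\<close>, whereas for \<open>x < 0\<close> the left-hand side of the Euler-Lagrange equation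
  is \<open>-1\<close>.\<close>

definition classical_flux :: "(real^'n) set \<Rightarrow> 'n lagrangian \<Rightarrow> (real^'n \<Rightarrow> real) \<Rightarrow> bool" where
  "classical_flux \<Omega> L u \<longleftrightarrow>
     (\<forall>j. (\<forall>x\<in>\<Omega>. has_pd j (along (Lz j L) u) x) \<and> continuous_on \<Omega> (pd j (along (Lz j L) u)))"

end

theory Submission
  imports Defs
begin

text \<open>Writing \<open>E\<close> for the left-hand side of the Euler-Lagrange equation along \<open>u\<close>, the left-hand side
  of the \<open>i\<close>-th Noether equation is \<open>u\<^sub>i E\<close>. For the converse, suppose \<open>u\<^sub>i E = 0\<close> for all \<open>i\<close> and
  \<open>E x\<^sub>0 \<noteq> 0\<close>. Near any point where \<open>E \<noteq> 0\<close>, \<open>u\<close> is a constant \<open>c\<close>, so the first structural hypothesis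
  gives \<open>E x = - L\<^sub>u(x, c, 0)\<close>, which is locally constant by the second one. Hence the set where
  \<open>(E, u) = (E x\<^sub>0, u x\<^sub>0)\<close> is open and closed in \<open>\<Omega>\<close>; so \<open>u\<close> is constant on \<open>\<Omega>\<close> and \<open>g\<close> is constant.\<close>

section \<open>Symmetry of the second derivative\<close>

text \<open>The mean value theorem is applied twice, first in direction \<open>h\<close> and then in
  direction \<open>k\<close>. The left-hand side is symmetric in \<open>h\<close> and
  \<open>k\<close> while the right-hand side is not; the symmetry of second derivatives comes from
  this contrast.\<close>

lemma second_difference_mvt:
  fixes f :: "'a::real_normed_vector \<Rightarrow> real"
    and f' :: "'a \<Rightarrow> 'a \<Rightarrow>\<^sub>L real" and f'' :: "'a \<Rightarrow> 'a \<Rightarrow>\<^sub>L 'a \<Rightarrow>\<^sub>L real"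
  assumes f': "\<And>y. y \<in> ball x r \<Longrightarrow> (f has_derivative f' y) (at y)"
    and f'': "\<And>y. y \<in> ball x r \<Longrightarrow> (f' has_derivative f'' y) (at y)"
    and t: "t > 0" "t * (norm h + norm k) < r"
  shows "\<exists>p. dist x p \<le> t * (norm h + norm k) \<and>
    f (x + t *\<^sub>R h + t *\<^sub>R k) - f (x + t *\<^sub>R h) - f (x + t *\<^sub>R k) + f x = t * t * f'' p k h"
proof -
  have bound: "norm (a *\<^sub>R h + b *\<^sub>R k) \<le> t * (norm h + norm k)"
    if "0 \<le> a" "a \<le> t" "0 \<le> b" "b \<le> t" for a b
  proof -
    have "norm (a *\<^sub>R h + b *\<^sub>R k) \<le> a * norm h + b * norm k"
      using norm_triangle_ineq[of "a *\<^sub>R h" "b *\<^sub>R k"] that by simp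
    also have "\<dots> \<le> t * norm h + t * norm k"
      using that by (intro add_mono mult_right_mono) auto
    finally show ?thesis by (simp add: distrib_left)
  qed
  have dist: "dist x (x + a *\<^sub>R h + b *\<^sub>R k) \<le> t * (norm h + norm k)"
    if "0 \<le> a" "a \<le> t" "0 \<le> b" "b \<le> t" for a b
    using bound[OF that] by (metis add.assoc add_diff_cancel_left' dist_commute dist_norm)
  have mem: "x + a *\<^sub>R h + b *\<^sub>R k \<in> ball x r"
    if "0 \<le> a" "a \<le> t" "0 \<le> b" "b \<le> t" for a b
    using dist[OF that] t(2) by simp
  have df: "((\<lambda>a. f (x + a *\<^sub>R h + b *\<^sub>R k)) has_field_derivative
      f' (x + a *\<^sub>R h + b *\<^sub>R k) h) (at a)"
    if "0 \<le> a" "a \<le> t" "0 \<le> b" "b \<le> t" for a b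
  proof -
    have "((\<lambda>a. x + a *\<^sub>R h + b *\<^sub>R k) has_derivative (\<lambda>s. s *\<^sub>R h)) (at a)"
      by (auto intro!: derivative_eq_intros)
    from has_derivative_compose[OF this f'[OF mem[OF that]]] show ?thesis
      by (simp add: has_field_derivative_def blinfun.scaleR_right mult.commute[of _ "f' _ h"])
  qed
  \<comment> \<open>The increment of \<open>f\<close> in direction \<open>k\<close>, as a function
    of the position along \<open>h\<close>. The summand \<open>0 *\<^sub>R k\<close> lets
    \<open>df\<close> apply to both terms, with \<open>b = t\<close> and
    \<open>b = 0\<close>.\<close>
  define \<phi> where "\<phi> a = f (x + a *\<^sub>R h + t *\<^sub>R k) - f (x + a *\<^sub>R h + 0 *\<^sub>R k)" for a
  have "(\<phi> has_field_derivative
      (f' (x + a *\<^sub>R h + t *\<^sub>R k) h - f' (x + a *\<^sub>R h + 0 *\<^sub>R k) h)) (at a)"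
    if "0 \<le> a" "a \<le> t" for a
    unfolding \<phi>_def using that t(1) by (intro DERIV_diff df) auto
  then obtain a where a: "0 < a" "a < t"
      "\<phi> t - \<phi> 0 = (t - 0) * (f' (x + a *\<^sub>R h + t *\<^sub>R k) h - f' (x + a *\<^sub>R h + 0 *\<^sub>R k) h)"
    using MVT2[of 0 t \<phi>
        "\<lambda>a. f' (x + a *\<^sub>R h + t *\<^sub>R k) h - f' (x + a *\<^sub>R h + 0 *\<^sub>R k) h"] t by blast
  \<comment> \<open>The difference produced by the first mean value step is
    \<open>\<psi> t - \<psi> 0\<close>, so a second mean value step in direction \<open>k\<close>
    brings in \<open>f''\<close>.\<close>
  define \<psi> where "\<psi> b = f' (x + a *\<^sub>R h + b *\<^sub>R k) h" for b
  have "(\<psi> has_field_derivative f'' (x + a *\<^sub>R h + b *\<^sub>R k) k h) (at b)"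
    if "0 \<le> b" "b \<le> t" for b
  proof -
    have "((\<lambda>b. x + a *\<^sub>R h + b *\<^sub>R k) has_derivative (\<lambda>s. s *\<^sub>R k)) (at b)"
      by (auto intro!: derivative_eq_intros)
    from has_derivative_compose[OF this f''[OF mem]] that a
    have "((\<lambda>b. f' (x + a *\<^sub>R h + b *\<^sub>R k)) has_derivative
        (\<lambda>s. f'' (x + a *\<^sub>R h + b *\<^sub>R k) (s *\<^sub>R k))) (at b)"
      by simp
    from bounded_linear.has_derivative[OF blinfun.bounded_linear_left this, of h]
    show ?thesis
      unfolding \<psi>_def has_field_derivative_def
      by (simp add: blinfun.scaleR_right blinfun.scaleR_left mult.commute[of _ "f'' _ k h"])
  qed
  then obtain b where b: "0 < b" "b < t"
      "\<psi> t - \<psi> 0 = (t - 0) * f'' (x + a *\<^sub>R h + b *\<^sub>R k) k h"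
    using MVT2[of 0 t \<psi> "\<lambda>b. f'' (x + a *\<^sub>R h + b *\<^sub>R k) k h"] t by blast
  show ?thesis
  proof (intro exI conjI)
    show "dist x (x + a *\<^sub>R h + b *\<^sub>R k) \<le> t * (norm h + norm k)"
      using a b by (intro dist) auto
    show "f (x + t *\<^sub>R h + t *\<^sub>R k) - f (x + t *\<^sub>R h) - f (x + t *\<^sub>R k) + f x
        = t * t * f'' (x + a *\<^sub>R h + b *\<^sub>R k) k h"
      using a(3) b(3) by (simp add: \<phi>_def \<psi>_def)
  qed
qed

text \<open>Exchanging \<open>h\<close> and \<open>k\<close> leaves the second difference unchanged,
  so its quotient by the squared step tends both to \<open>f'' x k h\<close> and to
  \<open>f'' x h k\<close>: the intermediate points converge to \<open>x\<close>, and
  \<open>f''\<close> is continuous there.\<close>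

lemma second_derivative_symmetric:
  fixes f :: "'a::real_normed_vector \<Rightarrow> real"
    and f' :: "'a \<Rightarrow> 'a \<Rightarrow>\<^sub>L real" and f'' :: "'a \<Rightarrow> 'a \<Rightarrow>\<^sub>L 'a \<Rightarrow>\<^sub>L real"
  assumes S: "open S" "x \<in> S"
    and f': "\<And>y. y \<in> S \<Longrightarrow> (f has_derivative f' y) (at y)"
    and f'': "\<And>y. y \<in> S \<Longrightarrow> (f' has_derivative f'' y) (at y)"
    and cont: "continuous_on S f''"
  shows "f'' x h k = f'' x k h"
proof -
  obtain r where r: "r > 0" "ball x r \<subseteq> S"
    using S openE by blast
  \<comment> \<open>The summand 1 keeps \<open>M\<close> positive when \<open>h\<close> and
    \<open>k\<close> are both zero.\<close>
  define M where "M = norm h + norm k + 1"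
  have M: "M > 0" by (simp add: M_def add_nonneg_pos)
  \<comment> \<open>Then \<open>t n * M = r / (n + 2)\<close>, which tends to 0 and is strictly
    below \<open>r\<close> already at \<open>n = 0\<close>; an offset of 1 would give equality
    there.\<close>
  define t where "t n = r / M / (real n + 2)" for n
  have t: "t n > 0" for n using r M by (simp add: t_def)
  have tM: "t n * (norm h + norm k) \<le> t n * M" for n
    using t[of n] by (intro mult_left_mono) (auto simp: M_def)
  have tM_eq: "t n * M = r / (real n + 2)" for n
    using M by (simp add: t_def)
  have tr: "t n * M < r" for n
    using r divide_strict_left_mono[of 1 "real n + 2" r] by (simp add: tM_eq)
  have t0: "(\<lambda>n. t n * M) \<longlonglongrightarrow> 0"
  proof -
    have "filterlim (\<lambda>n. 2 + real n) at_top sequentially"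
      by (rule filterlim_tendsto_add_at_top[OF tendsto_const filterlim_real_sequentially])
    then have "(\<lambda>n. r / (2 + real n)) \<longlonglongrightarrow> 0"
      by (rule real_tendsto_divide_at_top[OF tendsto_const])
    then show ?thesis by (simp add: tM_eq add.commute)
  qed
  define \<Delta> where
    "\<Delta> n = f (x + t n *\<^sub>R h + t n *\<^sub>R k) - f (x + t n *\<^sub>R h) - f (x + t n *\<^sub>R k) + f x" for n
  \<comment> \<open>Both orders of the two directions are treated at once; \<open>\<Delta> n\<close>
    is the same for either.\<close>
  have lim: "(\<lambda>n. \<Delta> n / (t n * t n)) \<longlonglongrightarrow> f'' x b a"
    if ab: "a = h \<and> b = k \<or> a = k \<and> b = h" for a b
  proof -
    have "\<exists>p. dist x p \<le> t n * (norm a + norm b) \<and>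
        f (x + t n *\<^sub>R a + t n *\<^sub>R b) - f (x + t n *\<^sub>R a) - f (x + t n *\<^sub>R b) + f x
          = t n * t n * f'' p b a" for n
      by (rule second_difference_mvt[of x r f f'])
        (use r t[of n] le_less_trans[OF tM tr, of n] ab in \<open>auto intro!: f' f'' simp: add.commute\<close>)
    moreover have "f (x + t n *\<^sub>R a + t n *\<^sub>R b) - f (x + t n *\<^sub>R a) - f (x + t n *\<^sub>R b) + f x = \<Delta> n"
      for n using ab by (auto simp: \<Delta>_def algebra_simps)
    moreover have "norm a + norm b = norm h + norm k" using ab by auto
    ultimately obtain p where p: "\<And>n. dist x (p n) \<le> t n * (norm h + norm k)"
        "\<And>n. \<Delta> n = t n * t n * f'' (p n) b a"
      by metis
    have "(\<lambda>n. dist (p n) x) \<longlonglongrightarrow> 0"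
      by (rule tendsto_sandwich[OF _ _ tendsto_const t0])
        (use order_trans[OF p(1) tM] in \<open>auto simp: dist_commute\<close>)
    then have "p \<longlonglongrightarrow> x" using tendsto_dist_iff by blast
    moreover have "isCont f'' x"
      using cont S continuous_on_eq_continuous_at by blast
    ultimately have "(\<lambda>n. f'' (p n)) \<longlonglongrightarrow> f'' x"
      using isCont_tendsto_compose by blast
    then have "(\<lambda>n. f'' (p n) b a) \<longlonglongrightarrow> f'' x b a"
      by (intro tendsto_intros)
    moreover have "\<Delta> n / (t n * t n) = f'' (p n) b a" for n
      using p(2)[of n] t[of n] by simp
    ultimately show ?thesis by simp
  qed
  show ?thesis
    using LIMSEQ_unique[OF lim[of h k] lim[of k h]] by simp
qed

section \<open>Partial derivatives on coordinate lines, and constancy when they vanish\<close>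

lemma DERIV_along_line:
  assumes "(f has_derivative f') (at x)"
  shows "((\<lambda>t. f (x + t *\<^sub>R a)) has_field_derivative f' a) (at 0)"
proof -
  interpret bounded_linear f' using assms by (rule has_derivative_bounded_linear)
  have "((\<lambda>t. f (x + t *\<^sub>R a)) has_derivative (\<lambda>t. f' (t *\<^sub>R a))) (at 0)"
    by (rule has_derivative_compose[of "\<lambda>t. x + t *\<^sub>R a" _ _ _ f])
      (use assms in \<open>auto intro!: derivative_eq_intros\<close>)
  then show ?thesis
    by (simp add: has_field_derivative_def scaleR mult.commute[of _ "f' a"])
qed

lemma has_derivative_imp_has_pd:
  assumes "(f has_derivative f') (at x)"
  shows "has_pd i f x"
  using DERIV_along_line[OF assms] field_differentiable_def has_pd_def by blast

lemma has_derivative_imp_pd: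
  assumes "(f has_derivative f') (at x)"
  shows "pd i f x = f' (axis i 1)"
  unfolding pd_def by (rule DERIV_imp_deriv[OF DERIV_along_line[OF assms]])

lemma has_pd_iff_DERIV:
  "has_pd i f x \<longleftrightarrow> ((\<lambda>t. f (x + t *\<^sub>R axis i 1)) has_field_derivative pd i f x) (at 0)"
  unfolding has_pd_def pd_def by (rule DERIV_deriv_iff_field_differentiable[symmetric])

lemma DERIV_imp_pd:
  assumes "((\<lambda>t. f (x + t *\<^sub>R axis i 1)) has_field_derivative d) (at 0)"
  shows "has_pd i f x" "pd i f x = d"
  using assms DERIV_imp_deriv
  by (auto simp: has_pd_def pd_def field_differentiable_def)

lemma pd_cong_open:
  assumes "open S" "x \<in> S" "\<And>y. y \<in> S \<Longrightarrow> f y = g y"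
  shows "pd i f x = pd i g x"
proof -
  have "((\<lambda>t. x + t *\<^sub>R axis i 1) \<longlongrightarrow> x + 0 *\<^sub>R axis i 1) (nhds (0::real))"
    by (intro tendsto_intros filterlim_ident)
  then have "\<forall>\<^sub>F t in nhds 0. x + t *\<^sub>R axis i 1 \<in> S"
    using assms(1,2) by (intro topological_tendstoD) auto
  then have "\<forall>\<^sub>F t in nhds 0. f (x + t *\<^sub>R axis i 1) = g (x + t *\<^sub>R axis i 1)"
    by eventually_elim (use assms(3) in auto)
  then show ?thesis unfolding pd_def by (intro deriv_cong_ev) auto
qed

text \<open>Parametrised by \<open>s\<close> in [0,1], the segment stays in \<open>S\<close> by
  convexity, and the derivative of \<open>f\<close> along it is \<open>d\<close> times a partial
  derivative, hence zero.\<close>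

lemma constant_on_line_if_pd_zero:
  assumes "convex S" "\<And>y. y \<in> S \<Longrightarrow> has_pd i f y \<and> pd i f y = 0"
    and "p \<in> S" "p + d *\<^sub>R axis i 1 \<in> S"
  shows "f (p + d *\<^sub>R axis i 1) = f p"
proof -
  have mem: "p + (s * d) *\<^sub>R axis i 1 \<in> S" if "0 \<le> s" "s \<le> 1" for s
  proof -
    have "(1 - s) *\<^sub>R p + s *\<^sub>R (p + d *\<^sub>R axis i 1) \<in> S"
      using convexD_alt[OF assms(1,3,4)] that by simp
    then show ?thesis by (simp add: algebra_simps)
  qed
  have "((\<lambda>s. f (p + (s * d) *\<^sub>R axis i 1)) has_field_derivative 0) (at s)"
    if "0 \<le> s" "s \<le> 1" for s
  proof -
    \<comment> \<open>The point 0 is written as \<open>s * d - s * d\<close>, the value at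
      \<open>s\<close> of the inner function in the chain rule below.\<close>
    have "((\<lambda>t. f (p + (s * d) *\<^sub>R axis i 1 + t *\<^sub>R axis i 1)) has_field_derivative 0)
        (at (s * d - s * d))"
      using assms(2)[OF mem[OF that], unfolded has_pd_iff_DERIV] by auto
    moreover have "((\<lambda>\<sigma>. \<sigma> * d - s * d) has_field_derivative d) (at s)"
      by (auto intro!: derivative_eq_intros)
    ultimately have "((\<lambda>\<sigma>. f (p + (s * d) *\<^sub>R axis i 1 + (\<sigma> * d - s * d) *\<^sub>R axis i 1))
        has_field_derivative 0 * d) (at s)"
      by (rule DERIV_chain2)
    then show ?thesis by (simp add: scaleR_left_diff_distrib)
  qed
  then have "((\<lambda>s. f (p + (s * d) *\<^sub>R axis i 1)) has_field_derivative 0) (at s within {0..1})"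
    if "s \<in> {0..1}" for s
    using that has_field_derivative_at_within by fastforce
  from has_field_derivative_zero_constant[OF _ this]
  obtain c where "\<And>s. s \<in> {0..1} \<Longrightarrow> f (p + (s * d) *\<^sub>R axis i 1) = c"
    by auto
  from this[of 0] this[of 1] show ?thesis by simp
qed

lemma constant_on_ball_if_pd_zero:
  fixes f :: "real^'n \<Rightarrow> real"
  assumes pd: "\<And>y i. y \<in> ball x r \<Longrightarrow> has_pd i f y \<and> pd i f y = 0"
    and y: "y \<in> ball x r"
  shows "f y = f x"
proof -
  define w where "w K = (\<chi> i. if i \<in> K then x $ i else y $ i)" for K
  have ball: "w K \<in> ball x r" for K
  proof -
    have "norm (x - w K) \<le> norm (x - y)"
      by (rule norm_le_componentwise_cart) (simp add: w_def)
    with y show ?thesis by (simp add: dist_norm)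
  qed
  have "f (w K) = f y" for K
    using finite[of K]
  proof induction
    case empty
    then show ?case by (simp add: w_def)
  next
    case (insert k K)
    have "w (insert k K) = w K + (x $ k - y $ k) *\<^sub>R axis k 1"
      using insert by (auto simp: w_def vec_eq_iff axis_def)
    with constant_on_line_if_pd_zero[OF convex_ball pd ball[of K], where i = k and d = "x $ k - y $ k"] ball[of "insert k K"] insert
    show ?case by simp
  qed
  from this[of UNIV] show ?thesis by (simp add: w_def)
qed

lemma C2_onE:
  assumes "C2_on S f"
  obtains f' f'' where "\<And>y. y \<in> S \<Longrightarrow> (f has_derivative blinfun_apply (f' y)) (at y)"
    and "\<And>y. y \<in> S \<Longrightarrow> (f' has_derivative blinfun_apply (f'' y)) (at y)"
    and "continuous_on S f''"
  using assms unfolding C2_on_def C1_on_def by metis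

lemma C1_closure_openE:
  assumes "C1_closure S f" "open S"
  obtains f' where "\<And>y. y \<in> S \<Longrightarrow> (f has_derivative blinfun_apply (f' y)) (at y)"
    and "continuous_on S f'"
proof -
  obtain F F' where F: "\<And>y. (F has_derivative blinfun_apply (F' y)) (at y)"
      "continuous_on UNIV F'" "\<And>y. y \<in> S \<Longrightarrow> f y = F y"
    using assms(1) unfolding C1_closure_def C1_on_def by blast
  show ?thesis
  proof
    show "(f has_derivative F' y) (at y)" if "y \<in> S" for y
      by (rule has_derivative_transform_within_open[OF F(1) assms(2) that]) (simp add: F(3))
    show "continuous_on S F'" using F(2) continuous_on_subset by blast
  qed
qed

lemma grad_eq:
  assumes "(u has_derivative blinfun_apply u') (at x)"
  shows "grad u x = (\<chi> i. u' (axis i 1))"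
  by (simp add: grad_def has_derivative_imp_pd[OF assms])

lemma has_derivative_grad:
  fixes u :: "real^'n \<Rightarrow> real"
  assumes "open S" "x \<in> S"
    and u': "\<And>y. y \<in> S \<Longrightarrow> (u has_derivative blinfun_apply (u' y)) (at y)"
    and u'': "(u' has_derivative blinfun_apply u'') (at x)"
  shows "(grad u has_derivative (\<lambda>h. \<chi> i. u'' h (axis i 1))) (at x)"
proof -
  have "((\<lambda>y. \<chi> i. u' y (axis i 1)) has_derivative (\<lambda>h. \<chi> i. u'' h (axis i 1))) (at x)"
    by (subst has_derivative_componentwise_within)
      (auto simp: Basis_vec_def inner_axis
        intro!: bounded_linear.has_derivative[OF blinfun.bounded_linear_left u''])
  then show ?thesis
    by (rule has_derivative_transform_within_open[OF _ assms(1,2)]) (simp add: grad_eq[OF u'])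
qed

lemma lagrangian_partials:
  fixes L :: "'n::finite lagrangian"
  assumes "((\<lambda>(x, u, z). L x u z) has_derivative D) (at (x, s, z))"
  shows "Lx i L x s z = D (axis i 1, 0, 0)" "Lu L x s z = D (0, 1, 0)"
    "Lz i L x s z = D (0, 0, axis i 1)"
proof -
  note line = DERIV_imp_deriv[OF DERIV_along_line[OF assms]]
  show "Lx i L x s z = D (axis i 1, 0, 0)"
    using line[of "(axis i 1, 0, 0)"] by (simp add: Lx_def pd_def)
  show "Lz i L x s z = D (0, 0, axis i 1)"
    using line[of "(0, 0, axis i 1)"] by (simp add: Lz_def pd_def)
  have "((\<lambda>t. (x, t, z)) has_derivative (\<lambda>h. (0, h, 0))) (at s)"
    by (auto intro!: derivative_eq_intros)
  from has_derivative_compose[OF this assms]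
  have "((\<lambda>t. L x t z) has_derivative (\<lambda>h. D (0, h, 0))) (at s)" by simp
  also have "(\<lambda>h. D (0, h, 0)) = (\<lambda>h. D (0, 1, 0) * h)"
  proof
    show "D (0, h, 0) = D (0, 1, 0) * h" for h
      using linear_scale[OF has_derivative_linear[OF assms], of h "(0, 1, 0)"] by simp
  qed
  finally show "Lu L x s z = D (0, 1, 0)"
    unfolding Lu_def has_field_derivative_def[symmetric] by (rule DERIV_imp_deriv)
qed

lemma has_derivative_lagrangian_sum:
  fixes L :: "'n::finite lagrangian"
  assumes D: "((\<lambda>(x, u, z). L x u z) has_derivative D) (at (x, s, z))"
  shows "D (axis i 1, a, w) = Lx i L x s z + a * Lu L x s z + (\<Sum>k\<in>UNIV. w $ k * Lz k L x s z)"
proof -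
  interpret D: linear D using D by (rule has_derivative_linear)
  have "(axis i 1, a, w) = (axis i 1, 0, 0) + (a *\<^sub>R (0, 1, 0) + (\<Sum>k\<in>UNIV. w $ k *\<^sub>R (0, 0, axis k 1)))"
    by (simp add: prod_eq_iff fst_sum snd_sum basis_expansion flip: scalar_mult_eq_scaleR)
  from arg_cong[OF this, of D] show ?thesis
    by (simp only: D.add D.scale D.sum lagrangian_partials[OF D] real_scaleR_def add.assoc)
qed

text \<open>The terms \<open>u\<^sub>i\<^sub>j L\<^sub>z\<^sub>j\<close> from the product rule and from \<open>\<partial>\<^sub>i L\<close> cancel because second derivatives
  are symmetric.\<close>

lemma noether_current_divergence:
  fixes L :: "'n::finite lagrangian"
  assumes \<Omega>: "open \<Omega>" "x \<in> \<Omega>" and u: "C2_on \<Omega> u"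
    and L: "((\<lambda>(x, u, z). L x u z) has_derivative D) (at (x, u x, grad u x))"
    and flux: "\<And>j. has_pd j (along (Lz j L) u) x"
  shows "has_pd j (along (energy_momentum L i j) u) x"
    and "(\<Sum>j\<in>UNIV. pd j (along (energy_momentum L i j) u) x) + along (Lx i L) u x =
      pd i u x * ((\<Sum>j\<in>UNIV. pd j (along (Lz j L) u) x) - along (Lu L) u x)"
proof -
  obtain u' u'' where u': "\<And>y. y \<in> \<Omega> \<Longrightarrow> (u has_derivative blinfun_apply (u' y)) (at y)"
    and u'': "\<And>y. y \<in> \<Omega> \<Longrightarrow> (u' has_derivative blinfun_apply (u'' y)) (at y)"
    and cont: "continuous_on \<Omega> u''"
    using C2_onE[OF u] by blast
  define H where "H i j = u'' x (axis i 1) (axis j 1)" for i j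
  have sym: "H i j = H j i" for i j
    unfolding H_def by (rule second_derivative_symmetric[OF \<Omega> u' u'' cont])
  note grad = has_derivative_grad[OF \<Omega> u' u''[OF \<Omega>(2)]]
  have along: "(along L u has_derivative (\<lambda>h. D (h, u' x h, \<chi> k. u'' x h (axis k 1)))) (at x)"
    using has_derivative_compose[OF has_derivative_Pair[OF has_derivative_ident
          has_derivative_Pair[OF u'[OF \<Omega>(2)] grad]] L]
    by (simp add: along_def[abs_def])
  have along_pd: "pd j (along L u) x =
      along (Lx j L) u x + pd j u x * along (Lu L) u x + (\<Sum>k\<in>UNIV. H j k * along (Lz k L) u x)" for j
    using has_derivative_lagrangian_sum[OF L, of j]
    by (simp add: has_derivative_imp_pd[OF along] has_derivative_imp_pd[OF u'[OF \<Omega>(2)]]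
        along_def H_def)
  have grad_pd: "((\<lambda>t. grad u (x + t *\<^sub>R axis j 1) $ i) has_field_derivative H j i) (at 0)" for j
    using DERIV_along_line[OF bounded_linear.has_derivative[OF bounded_linear_vec_nth grad], of "axis j 1" i]
    by (simp add: H_def)
  have T: "((\<lambda>t. along (energy_momentum L i j) u (x + t *\<^sub>R axis j 1)) has_field_derivative
      (H j i * along (Lz j L) u x + pd i u x * pd j (along (Lz j L) u) x
        - (if i = j then pd j (along L u) x else 0))) (at 0)" for j
  proof -
    have "((\<lambda>t. grad u (x + t *\<^sub>R axis j 1) $ i * along (Lz j L) u (x + t *\<^sub>R axis j 1))
        has_field_derivative (H j i * along (Lz j L) u x + pd i u x * pd j (along (Lz j L) u) x)) (at 0)"
      using DERIV_mult[OF grad_pd[of j] flux[of j, unfolded has_pd_iff_DERIV]]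
      by (simp add: grad_def mult.commute add.commute)
    moreover have "((\<lambda>t. if i = j then along L u (x + t *\<^sub>R axis j 1) else 0)
        has_field_derivative (if i = j then pd j (along L u) x else 0)) (at 0)"
      using has_derivative_imp_has_pd[OF along, of j] by (simp add: has_pd_iff_DERIV)
    ultimately show ?thesis
      by (auto simp: along_def[of "energy_momentum L i j"] energy_momentum_def along_def[of "Lz j L"] along_def[of L]
         dest: DERIV_diff)
  qed
  show "has_pd j (along (energy_momentum L i j) u) x"
    using DERIV_imp_pd(1)[OF T] .
  have "(\<Sum>j\<in>UNIV. pd j (along (energy_momentum L i j) u) x) =
      (\<Sum>j\<in>UNIV. H j i * along (Lz j L) u x) + pd i u x * (\<Sum>j\<in>UNIV. pd j (along (Lz j L) u) x)
      - pd i (along L u) x"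
    by (simp add: DERIV_imp_pd(2)[OF T] sum.distrib sum_subtractf sum_distrib_left)
  moreover have "(\<Sum>j\<in>UNIV. H j i * along (Lz j L) u x) = (\<Sum>j\<in>UNIV. H i j * along (Lz j L) u x)"
    by (simp add: sym[of _ i])
  ultimately show "(\<Sum>j\<in>UNIV. pd j (along (energy_momentum L i j) u) x) + along (Lx i L) u x =
      pd i u x * ((\<Sum>j\<in>UNIV. pd j (along (Lz j L) u) x) - along (Lu L) u x)"
    using along_pd[of i] by (simp add: algebra_simps)
qed

lemma constant_on_imp_frontier_limit_constant_on:
  fixes u g :: "real^'n \<Rightarrow> real"
  assumes "open \<Omega>" "\<And>x. x \<in> \<Omega> \<Longrightarrow> u x = c"
    and "\<And>x. x \<in> frontier \<Omega> \<Longrightarrow> (u \<longlongrightarrow> g x) (at x within \<Omega>)"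
  shows "g constant_on frontier \<Omega>"
proof -
  have "g p = c" if p: "p \<in> frontier \<Omega>" for p
  proof -
    have "p \<in> closure \<Omega>" "p \<notin> \<Omega>"
      using p assms(1) by (auto simp: frontier_def interior_open)
    then have "\<not> trivial_limit (at p within \<Omega>)"
      by (simp add: trivial_limit_within closure_def)
    moreover have "(u \<longlongrightarrow> c) (at p within \<Omega>)"
      by (rule tendsto_eventually) (auto simp: eventually_at_filter assms(2))
    ultimately show ?thesis
      using assms(3)[OF p] tendsto_unique by blast
  qed
  then show ?thesis unfolding constant_on_def by blast
qed

theorem theorem4:
  fixes \<Omega> :: "(real^'n) set"
    and g :: "real^'n \<Rightarrow> real"
    and L :: "real^'n \<Rightarrow> real \<Rightarrow> real^'n \<Rightarrow> real"
  assumes "open \<Omega>" and "connected \<Omega>" and "bounded \<Omega>"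
    and "continuous_on (frontier \<Omega>) g"
    and "\<not> g constant_on frontier \<Omega>"
    and "C1_closure (\<Omega> \<times> UNIV) (\<lambda>(x, u, z). L x u z)"
    and "\<And>x s. x \<in> \<Omega> \<Longrightarrow>
           (\<forall>i. has_pd i (\<lambda>y. Lz i L y s 0) x) \<and> (\<Sum>i\<in>UNIV. Lx i (Lz i L) x s 0) = 0"
    and "\<And>x s i. x \<in> \<Omega> \<Longrightarrow>
           has_pd i (\<lambda>y. Lu L y s 0) x \<and> Lx i (Lu L) x s 0 = 0"
  shows "\<forall>u\<in>admissible \<Omega> g.
           (euler_lagrange \<Omega> L u \<longrightarrow> noether \<Omega> L u) \<and>
           (classical_flux \<Omega> L u \<longrightarrow> (euler_lagrange \<Omega> L u \<longleftrightarrow> noether \<Omega> L u))"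
proof
  fix u assume "u \<in> admissible \<Omega> g"
  then have u: "C2_on \<Omega> u" and ug: "\<And>x. x \<in> frontier \<Omega> \<Longrightarrow> (u \<longlongrightarrow> g x) (at x within \<Omega>)"
    by (auto simp: admissible_def)
  obtain u' u'' where u': "\<And>y. y \<in> \<Omega> \<Longrightarrow> (u has_derivative blinfun_apply (u' y)) (at y)"
    and u'': "\<And>y. y \<in> \<Omega> \<Longrightarrow> (u' has_derivative blinfun_apply (u'' y)) (at y)"
    and "continuous_on \<Omega> u''"
    using C2_onE[OF u] by blast
  obtain L' where L': "\<And>y. y \<in> \<Omega> \<times> UNIV \<Longrightarrow>
      ((\<lambda>(x, u, z). L x u z) has_derivative blinfun_apply (L' y)) (at y)"
    and L'_cont: "continuous_on (\<Omega> \<times> UNIV) L'"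
    by (rule C1_closure_openE[OF assms(6) open_Times[OF assms(1) open_UNIV]], rule that)
  define E where "E x = (\<Sum>j\<in>UNIV. pd j (along (Lz j L) u) x) - along (Lu L) u x" for x
  note current = noether_current_divergence[OF assms(1) _ u L', folded E_def]
  have EL_noether: "noether \<Omega> L u" if "euler_lagrange \<Omega> L u"
    using that current by (auto simp: noether_def euler_lagrange_def E_def[symmetric])
  moreover have "euler_lagrange \<Omega> L u" if flux: "classical_flux \<Omega> L u" and "noether \<Omega> L u"
  proof -
    have uE: "pd i u x * E x = 0" if "x \<in> \<Omega>" for x i
      using that current[of x i] \<open>noether \<Omega> L u\<close> flux
      by (auto simp: noether_def classical_flux_def)
    have u_cont: "continuous_on \<Omega> u"
      using u' by (meson continuous_at_imp_continuous_on has_derivative_continuous)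
    have "continuous_on \<Omega> (grad u)"
      by (meson has_derivative_grad[OF assms(1) _ u' u''] continuous_at_imp_continuous_on
          has_derivative_continuous)
    then have "continuous_on \<Omega> (\<lambda>x. L' (x, u x, grad u x) (0, 1, 0))"
      using u_cont
      by (auto intro!: continuous_intros continuous_on_compose2[OF L'_cont])
    moreover have "along (Lu L) u x = L' (x, u x, grad u x) (0, 1, 0)" if "x \<in> \<Omega>" for x
      using lagrangian_partials(2)[OF L'] that by (simp add: along_def)
    ultimately have "continuous_on \<Omega> (along (Lu L) u)"
      by (simp cong: continuous_on_cong)
    then have E_cont: "continuous_on \<Omega> E"
      unfolding E_def using flux
      by (auto simp: classical_flux_def intro!: continuous_intros)
    have "E x0 = 0" if x0: "x0 \<in> \<Omega>" for x0
    proof (rule ccontr)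
      assume nz: "E x0 \<noteq> 0"
      define A where "A = {x \<in> \<Omega>. (E x, u x) = (E x0, u x0)}"
      have "closedin (top_of_set \<Omega>) A"
        unfolding A_def
        by (intro continuous_closedin_preimage_constant continuous_intros E_cont u_cont)
      moreover have "openin (top_of_set \<Omega>) A"
      proof -
        have "\<exists>r>0. ball a r \<subseteq> A" if a: "a \<in> A" for a
        proof -
          have a\<Omega>: "a \<in> \<Omega>" and Ea: "E a = E x0" and ua: "u a = u x0"
            using a by (auto simp: A_def)
          have "open (\<Omega> \<inter> E -` (- {0}))"
            by (intro continuous_open_preimage E_cont assms(1) open_Compl closed_singleton)
          moreover have "a \<in> \<Omega> \<inter> E -` (- {0})"
            using a\<Omega> Ea nz by simp
          ultimately obtain r where "r > 0" "ball a r \<subseteq> \<Omega> \<inter> E -` (- {0})"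
            by (rule openE)
          then have r: "r > 0" "ball a r \<subseteq> \<Omega>" "\<And>y. y \<in> ball a r \<Longrightarrow> E y \<noteq> 0"
            by auto
          have du: "pd i u y = 0" if "y \<in> ball a r" for y i
            using uE[of y i] r(2) r(3)[OF that] that by auto
          have u_const: "u y = u x0" if "y \<in> ball a r" for y
          proof -
            have "has_pd i u y \<and> pd i u y = 0" if "y \<in> ball a r" for y i
              using du that has_derivative_imp_has_pd[OF u'] r by blast
            from constant_on_ball_if_pd_zero[OF this \<open>y \<in> ball a r\<close>] show ?thesis
              using ua by simp
          qed
          have grad0: "grad u y = 0" if "y \<in> ball a r" for y
            using du[OF that] by (simp add: grad_def vec_eq_iff)
          have E_eq: "E y = - Lu L y (u x0) 0" if y: "y \<in> ball a r" for y
          proof -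
            have "pd j (along (Lz j L) u) y = Lx j (Lz j L) y (u x0) 0" for j
              unfolding Lx_def
              by (rule pd_cong_open[OF open_ball y]) (simp add: along_def grad0 u_const)
            then show ?thesis
              using assms(7)[of y "u x0"] y r
              by (auto simp: E_def along_def grad0 u_const)
          qed
          have "E y = E x0" if y: "y \<in> ball a r" for y
          proof -
            have "has_pd i (\<lambda>y. Lu L y (u x0) 0) y \<and> pd i (\<lambda>y. Lu L y (u x0) 0) y = 0"
              if "y \<in> ball a r" for y i
              using assms(8)[of y i "u x0"] r that by (auto simp: Lx_def)
            from constant_on_ball_if_pd_zero[OF this y] show ?thesis
              using E_eq y r(1) Ea by simp
          qed
          then have "ball a r \<subseteq> A"
            using r u_const by (auto simp: A_def)
          with r show ?thesis by blast
        qed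
        then have "open A" by (simp add: open_contains_ball)
        then show ?thesis by (auto simp: A_def intro: open_subset)
      qed
      ultimately have "A = \<Omega>"
        using assms(2) x0 unfolding connected_clopen A_def by blast
      then have "\<And>x. x \<in> \<Omega> \<Longrightarrow> u x = u x0" by (auto simp: A_def)
      with assms(1,5) ug show False
        using constant_on_imp_frontier_limit_constant_on by blast
    qed
    then show ?thesis
      using flux by (auto simp: euler_lagrange_def classical_flux_def E_def)
  qed
  ultimately show "(euler_lagrange \<Omega> L u \<longrightarrow> noether \<Omega> L u) \<and>
      (classical_flux \<Omega> L u \<longrightarrow> (euler_lagrange \<Omega> L u \<longleftrightarrow> noether \<Omega> L u))"
    by blast
qed

end
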